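(* Let $q$ be any prime power, let $d\ge2$, let $X\subseteq\mathbb F_q^d$ be nonempty, and let $\mathcal H$ be a nonempty family of distinct affine hyperplanes of $\mathbb F_q^d$. Put $$n=|X|,\qquad h=|\mathcal H|,\qquad I_H=I(X,\mathcal H),\qquad\mathcal E_H=\frac{I_H^2}n-I_H.$$ If $\mathcal E_H>0$, then for every $0<\eta<1$, the ordered pairs $(H,H')\in\mathcal H^2$, $H\ne H'$, satisfying $$|X\cap H\cap H'|\ge\eta\frac{\mathcal E_H}{h^2}$$ carry at least $(1-\eta)\mathcal E_H$ units of coincidence energy, i.e. the sum of $|X\cap H\cap H'|$ over these pairs is at least $(1-\eta)\mathcal E_H$. In particular, there are at least $$\frac{(1-\eta)\mathcal E_H}{q^{d-2}}$$ ordered such pairs, all nonparallel. If, more specifically, $K>0$ and $$I(X,\mathcal H)-\frac{nh}q\ge Kq^{(d-1)/2}\sqrt{nh},\qquad K^2q^{d-1}h\ge4n,$$ then at least $K^2qh/4$ ordered nonparallel pairs satisfy $$|X\cap H\cap H'|\ge\frac{K^2q^{d-1}}{4h}.$$ Under the additional cap $h\le C_1Kq^{(d-1)/2}$, where $C_1\ge1$, the right-hand side of the last inequality is at least $Kq^{(d-1)/2}/(4C_1)$.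
   Context: $I(X,\mathcal H)=|\{(x,H)\in X\times\mathcal H:x\in H\}|$. *)

theory Defs
  imports "HOL-Analysis.Analysis"
begin

text \<open>The vector space $F_q^d$ is the type \<open>'k ^ 'd\<close> with \<open>'k :: {field, finite}\<close>,
  \<open>q = CARD('k)\<close> and \<open>d = CARD('d)\<close>. The HOL-Analysis constant \<open>affine\<close> is restricted to real
  vector spaces, so hyperplanes are built from \<open>vec.subspace\<close> and \<open>vec.dim\<close>, which work over
  an arbitrary field.\<close>

definition affine_hyperplane :: "('k::field ^ 'd) set \<Rightarrow> bool" where
  "affine_hyperplane H \<longleftrightarrow>
     (\<exists>v W. vec.subspace W \<and> vec.dim W + 1 = CARD('d) \<and> H = (\<lambda>w. v + w) ` W)"

text \<open>For hyperplanes, being translates of each other means having the same direction space;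
  every hyperplane is parallel to itself.\<close>

definition parallel :: "('k::field ^ 'd) set \<Rightarrow> ('k ^ 'd) set \<Rightarrow> bool" where
  "parallel H H' \<longleftrightarrow> (\<exists>v. H' = (\<lambda>w. v + w) ` H)"

definition incidences :: "'a set \<Rightarrow> 'a set set \<Rightarrow> nat" where
  "incidences X \<H> = card {(x, H) \<in> X \<times> \<H>. x \<in> H}"

definition hyperplane_energy :: "'a set \<Rightarrow> 'a set set \<Rightarrow> real" where
  "hyperplane_energy X \<H> =
     (real (incidences X \<H>))\<^sup>2 / real (card X) - real (incidences X \<H>)"

definition rich_pairs :: "'a set \<Rightarrow> 'a set set \<Rightarrow> real \<Rightarrow> ('a set \<times> 'a set) set" where
  "rich_pairs X \<H> t =
     {(H, H') \<in> \<H> \<times> \<H>. H \<noteq> H' \<and> real (card (X \<inter> H \<inter> H')) \<ge> t}"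

end

theory Submission
  imports Defs
begin

text \<open>Counting ordered pairs of distinct members of the family through a common point and applying
  Cauchy--Schwarz to the multiplicities shows that the total coincidence energy is at least
  \<open>\<E>\<close>. The pairs below the threshold \<open>\<eta>\<E> / h\<^sup>2\<close> carry at most \<open>\<eta>\<E>\<close>, since there are at most
  \<open>h\<^sup>2\<close> of them. A surviving pair of distinct hyperplanes meets, hence is not parallel and meets in
  at most \<open>q ^ (d - 2)\<close> points. Under the incidence assumption \<open>I \<ge> 2n\<close>, so
  \<open>\<E> \<ge> I\<^sup>2 / (2n) \<ge> K\<^sup>2 q ^ (d - 1) h / 2\<close>, and \<open>\<eta> = 1/2\<close> gives the second part.\<close>

section \<open>Affine hyperplanes over a finite field\<close>

lemma card_subspace_le:
  fixes W :: "('k::{field,finite} ^ 'd::finite) set"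
  assumes "vec.subspace W"
  shows "card W \<le> CARD('k) ^ vec.dim W"
proof -
  obtain B where B: "B \<subseteq> W" "W \<subseteq> vec.span B" "card B = vec.dim W"
    using vec.basis_exists[of W] by metis
  have "finite B" by simp
  let ?F = "B \<rightarrow>\<^sub>E (UNIV :: 'k set)"
  have "W \<subseteq> (\<lambda>u. \<Sum>v\<in>B. u v *s v) ` ?F"
  proof
    fix w assume "w \<in> W"
    then obtain u where "w = (\<Sum>v\<in>B. u v *s v)"
      using B(2) vec.span_finite[OF \<open>finite B\<close>] by auto
    \<comment> \<open>Restricting the coefficients to \<open>B\<close> puts them into the
      extensional function space \<open>?F\<close>, which has exactly q^|B| elements.\<close>
    also have "\<dots> = (\<Sum>v\<in>B. restrict u B v *s v)"
      by (rule sum.cong) auto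
    finally show "w \<in> (\<lambda>u. \<Sum>v\<in>B. u v *s v) ` ?F"
      by (intro image_eqI[of _ _ "restrict u B"]) auto
  qed
  moreover have "finite ?F" using \<open>finite B\<close> by (intro finite_PiE) auto
  ultimately have "card W \<le> card ?F"
    by (meson card_image_le card_mono finite_imageI order_trans)
  also have "\<dots> = CARD('k) ^ vec.dim W"
    using \<open>finite B\<close> B(3) by (simp add: card_PiE)
  finally show ?thesis .
qed

text \<open>The base point of a hyperplane can be moved to any of its points. Two hyperplanes
  through \<open>x\<close> thus get the same base point, which reduces their intersection to that of
  their direction spaces.\<close>

lemma affine_hyperplane_through:
  fixes H :: "('k::field ^ 'd::finite) set"
  assumes "affine_hyperplane H" "x \<in> H"
  obtains W where "vec.subspace W" "vec.dim W + 1 = CARD('d)" "H = (\<lambda>w. x + w) ` W"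
proof -
  obtain v W where W: "vec.subspace W" "vec.dim W + 1 = CARD('d)" "H = (\<lambda>w. v + w) ` W"
    using assms(1) unfolding affine_hyperplane_def by blast
  obtain w0 where w0: "w0 \<in> W" "x = v + w0" using assms(2) W(3) by blast
  have "(\<lambda>w. v + w) ` W = (\<lambda>w. x + w) ` W"
  proof (intro equalityI image_subsetI)
    fix w assume "w \<in> W"
    then have "w - w0 \<in> W" using w0 W(1) by (simp add: vec.subspace_diff)
    then show "v + w \<in> (\<lambda>w. x + w) ` W"
      by (rule rev_image_eqI) (simp add: w0(2))
  next
    fix w assume "w \<in> W"
    then have "w0 + w \<in> W" using w0 W(1) by (simp add: vec.subspace_add)
    then show "x + w \<in> (\<lambda>w. v + w) ` W"
      by (rule rev_image_eqI) (simp add: w0(2) add.assoc)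
  qed
  with W that show ?thesis by blast
qed

text \<open>Since \<open>x\<close> lies in both sets, the translation vector is forced into the
  direction space \<open>W\<close>, and translating by such a vector maps \<open>H\<close> to
  itself.\<close>

lemma parallel_meeting_eq:
  fixes H H' :: "('k::field ^ 'd::finite) set"
  assumes "affine_hyperplane H" "parallel H H'" "x \<in> H" "x \<in> H'"
  shows "H = H'"
proof -
  obtain W where W: "vec.subspace W" "H = (\<lambda>w. x + w) ` W"
    using affine_hyperplane_through[OF assms(1,3)] by metis
  obtain v where v: "H' = (\<lambda>w. v + w) ` H" using assms(2) unfolding parallel_def by blast
  then obtain w where w: "w \<in> W" "x = v + (x + w)" using W(2) assms(4) by auto
  then have vw: "v = - w"
    by (metis add.left_commute add_cancel_left_right eq_neg_iff_add_eq_0)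
  have "H' = (\<lambda>u. x + (u - w)) ` W"
    unfolding v W(2) image_image vw by (simp add: algebra_simps)
  also have "\<dots> = (\<lambda>u. x + u) ` (\<lambda>u. u - w) ` W" by (simp add: image_image)
  also have "(\<lambda>u. u - w) ` W = W"
  proof (intro equalityI image_subsetI subsetI)
    fix u assume "u \<in> W"
    then show "u - w \<in> W" using w(1) W(1) by (simp add: vec.subspace_diff)
  next
    fix u assume "u \<in> W"
    then have "u + w \<in> W" using w(1) W(1) by (simp add: vec.subspace_add)
    then show "u \<in> (\<lambda>u. u - w) ` W" by (rule rev_image_eqI) simp
  qed
  finally show ?thesis using W(2) by simp
qed

text \<open>If the hyperplanes meet, their intersection is a translate of
  \<open>W \<inter> W'\<close>, a proper subspace of \<open>W\<close>, so its dimension falls below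
  d - 1.\<close>

lemma card_hyperplane_Int_le:
  fixes H H' :: "('k::{field,finite} ^ 'd::finite) set"
  assumes "affine_hyperplane H" "affine_hyperplane H'" "H \<noteq> H'"
  shows "card (H \<inter> H') \<le> CARD('k) ^ (CARD('d) - 2)"
proof (cases "H \<inter> H' = {}")
  case False
  then obtain x where x: "x \<in> H" "x \<in> H'" by blast
  obtain W where W: "vec.subspace W" "vec.dim W + 1 = CARD('d)" "H = (\<lambda>w. x + w) ` W"
    using affine_hyperplane_through[OF assms(1) x(1)] .
  obtain W' where W': "vec.subspace W'" "vec.dim W' + 1 = CARD('d)" "H' = (\<lambda>w. x + w) ` W'"
    using affine_hyperplane_through[OF assms(2) x(2)] .
  \<comment> \<open>As the dimensions agree, inclusion would give \<open>W = W'\<close> and hence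
    \<open>H = H'\<close>.\<close>
  have "\<not> W \<subseteq> W'"
    using assms(3) W W' vec.subspace_dim_equal[of W W'] by auto
  have sub: "vec.subspace (W \<inter> W')" using W(1) W'(1) by (rule vec.subspace_inter)
  have "vec.dim (W \<inter> W') \<noteq> vec.dim W"
    using \<open>\<not> W \<subseteq> W'\<close> vec.subspace_dim_equal[OF sub W(1)] by auto
  moreover have "vec.dim (W \<inter> W') \<le> vec.dim W" by (rule vec.dim_subset) blast
  \<comment> \<open>The strict drop makes \<open>vec.dim W\<close> positive, so d is at least 2 here
    and the natural-number subtraction is not truncated.\<close>
  ultimately have dim: "vec.dim (W \<inter> W') \<le> CARD('d) - 2" using W(2) by linarith
  have "H \<inter> H' = (\<lambda>w. x + w) ` (W \<inter> W')" unfolding W(3) W'(3) by auto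
  then have "card (H \<inter> H') = card (W \<inter> W')" by (simp add: card_image)
  also have "\<dots> \<le> CARD('k) ^ vec.dim (W \<inter> W')" by (rule card_subspace_le[OF sub])
  also have "\<dots> \<le> CARD('k) ^ (CARD('d) - 2)"
    using dim by (intro power_increasing) (auto simp: Suc_le_eq)
  finally show ?thesis .
qed simp

section \<open>Double counting of coincidences\<close>

lemma incidences_eq_sum:
  assumes "finite X" "finite \<H>"
  shows "incidences X \<H> = (\<Sum>x\<in>X. card {H\<in>\<H>. x \<in> H})"
proof -
  have "{(x, H) \<in> X \<times> \<H>. x \<in> H} = (SIGMA x:X. {H\<in>\<H>. x \<in> H})" by auto
  then show ?thesis unfolding incidences_def using assms by simp
qed

text \<open>Both sides count triples (x, H, H') with x in both hyperplanes, grouped by pair or by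
  point.\<close>

lemma sum_card_Int_eq:
  assumes "finite X" "finite \<H>"
  shows "(\<Sum>(H, H')\<in>\<H> \<times> \<H>. card (X \<inter> H \<inter> H')) = (\<Sum>x\<in>X. (card {H\<in>\<H>. x \<in> H})\<^sup>2)"
proof -
  have "(\<Sum>(H, H')\<in>\<H> \<times> \<H>. card (X \<inter> H \<inter> H'))
      = (\<Sum>p\<in>\<H> \<times> \<H>. \<Sum>x\<in>X. if x \<in> fst p \<and> x \<in> snd p then 1 else 0)"
    using assms(1)
    by (intro sum.cong)
      (auto simp: sum.If_cases Int_def case_prod_beta intro!: arg_cong[where f = card])
  also have "\<dots> = (\<Sum>x\<in>X. \<Sum>p\<in>\<H> \<times> \<H>. if x \<in> fst p \<and> x \<in> snd p then 1 else 0)"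
    by (rule sum.swap)
  also have "\<dots> = (\<Sum>x\<in>X. (card {H\<in>\<H>. x \<in> H})\<^sup>2)"
  proof (rule sum.cong[OF refl])
    fix x
    have "{p \<in> \<H> \<times> \<H>. x \<in> fst p \<and> x \<in> snd p} = {H\<in>\<H>. x \<in> H} \<times> {H\<in>\<H>. x \<in> H}" by auto
    then show "(\<Sum>p\<in>\<H> \<times> \<H>. if x \<in> fst p \<and> x \<in> snd p then 1 else 0)
        = (card {H\<in>\<H>. x \<in> H})\<^sup>2"
      using assms(2) by (simp add: card_cartesian_product power2_eq_square flip: sum.inter_filter)
  qed
  finally show ?thesis .
qed

lemma hyperplane_energy_le_sum:
  assumes "finite X" "finite \<H>"
  shows "hyperplane_energy X \<H>
    \<le> (\<Sum>(H, H')\<in>{(H, H')\<in>\<H> \<times> \<H>. H \<noteq> H'}. real (card (X \<inter> H \<inter> H')))"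
proof -
  let ?f = "\<lambda>(H, H'). real (card (X \<inter> H \<inter> H'))"
  let ?O = "{(H, H')\<in>\<H> \<times> \<H>. H \<noteq> H'}" and ?D = "(\<lambda>H. (H, H)) ` \<H>"
  let ?r = "\<lambda>x. real (card {H\<in>\<H>. x \<in> H})"
  have I: "real (incidences X \<H>) = (\<Sum>x\<in>X. ?r x)"
    using incidences_eq_sum[OF assms] by simp
  \<comment> \<open>Counting incidences by hyperplane identifies the diagonal pairs with the term
    subtracted in the energy.\<close>
  have "real (incidences X \<H>) = (\<Sum>H\<in>\<H>. real (card (X \<inter> H)))"
  proof -
    have "{(x, H) \<in> X \<times> \<H>. x \<in> H} = prod.swap ` (SIGMA H:\<H>. X \<inter> H)" by auto
    then show ?thesis unfolding incidences_def using assms by (simp add: card_image)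
  qed
  also have "\<dots> = sum ?f ?D" by (subst sum.reindex) (auto simp: inj_on_def Int_assoc)
  finally have D: "sum ?f ?D = real (incidences X \<H>)" by simp
  have O: "?O = \<H> \<times> \<H> - ?D" by auto
  have split: "sum ?f (\<H> \<times> \<H>) = sum ?f ?O + sum ?f ?D"
    unfolding O by (rule sum.subset_diff) (use assms(2) in auto)
  have "sum ?f (\<H> \<times> \<H>) = real (\<Sum>(H, H')\<in>\<H> \<times> \<H>. card (X \<inter> H \<inter> H'))"
    by (simp add: case_prod_beta)
  also have "\<dots> = (\<Sum>x\<in>X. (?r x)\<^sup>2)"
    unfolding sum_card_Int_eq[OF assms] by simp
  finally have sq: "sum ?f (\<H> \<times> \<H>) = (\<Sum>x\<in>X. (?r x)\<^sup>2)" .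
  have "(\<Sum>x\<in>X. ?r x)\<^sup>2 \<le> real (card X) * (\<Sum>x\<in>X. (?r x)\<^sup>2)"
    using sum_squared_le_sum_of_squares by (simp add: mult.commute)
  then have "(real (incidences X \<H>))\<^sup>2 / real (card X) \<le> (\<Sum>x\<in>X. (?r x)\<^sup>2)"
    unfolding I
    \<comment> \<open>For empty \<open>X\<close> the quotient is 0 by the convention on division by
      zero.\<close>
    by (cases "card X = 0") (auto simp: divide_le_eq mult.commute intro!: sum_nonneg)
  with sq split D show ?thesis unfolding hyperplane_energy_def by linarith
qed

section \<open>Energy and number of rich pairs\<close>

lemma rich_pairs_energy_ge:
  assumes "finite X" "finite \<H>" "0 \<le> t"
  shows "hyperplane_energy X \<H> - t * (real (card \<H>))\<^sup>2
    \<le> (\<Sum>(H, H')\<in>rich_pairs X \<H> t. real (card (X \<inter> H \<inter> H')))"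
proof -
  let ?f = "\<lambda>(H, H'). real (card (X \<inter> H \<inter> H'))"
  let ?O = "{(H, H')\<in>\<H> \<times> \<H>. H \<noteq> H'}" and ?R = "rich_pairs X \<H> t"
  have fin: "finite (\<H> \<times> \<H>)" using assms by simp
  have finO: "finite ?O" by (rule finite_subset[OF _ fin]) auto
  have sub: "?R \<subseteq> ?O" unfolding rich_pairs_def by auto
  have "sum ?f (?O - ?R) \<le> real (card (?O - ?R)) * t"
    by (rule sum_bounded_above) (auto simp: rich_pairs_def)
  also have "card (?O - ?R) \<le> card (\<H> \<times> \<H>)" by (rule card_mono[OF fin]) auto
  then have "real (card (?O - ?R)) * t \<le> (real (card \<H>))\<^sup>2 * t"
    using assms(3)
    by (intro mult_right_mono)
      (simp_all add: card_cartesian_product power2_eq_square flip: of_nat_mult)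
  finally have "sum ?f (?O - ?R) \<le> t * (real (card \<H>))\<^sup>2" by (simp add: mult.commute)
  moreover have "sum ?f ?O = sum ?f (?O - ?R) + sum ?f ?R"
    by (rule sum.subset_diff[OF sub finO])
  ultimately show ?thesis using hyperplane_energy_le_sum[OF assms(1,2)] by linarith
qed

text \<open>A positive threshold forces a common point, and parallel hyperplanes with a common point
  coincide.\<close>

lemma rich_pairs_not_parallel:
  fixes X :: "('k::field ^ 'd::finite) set"
  assumes "\<forall>H\<in>\<H>. affine_hyperplane H" "0 < t" "(H, H') \<in> rich_pairs X \<H> t"
  shows "\<not> parallel H H'"
proof
  assume "parallel H H'"
  moreover have *: "H \<in> \<H>" "H \<noteq> H'" "t \<le> real (card (X \<inter> H \<inter> H'))"
    using assms(3) by (auto simp: rich_pairs_def)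
  moreover from this assms(2) have "X \<inter> H \<inter> H' \<noteq> {}" by (metis card.empty of_nat_0 not_le)
  ultimately show False using parallel_meeting_eq[of H H'] assms(1) by blast
qed

text \<open>This turns a lower bound on the energy carried by rich pairs into a lower bound on their
  number.\<close>

lemma sum_rich_pairs_le:
  fixes X :: "('k::{field,finite} ^ 'd::finite) set"
  assumes "\<forall>H\<in>\<H>. affine_hyperplane H"
  shows "(\<Sum>(H, H')\<in>rich_pairs X \<H> t. real (card (X \<inter> H \<inter> H')))
    \<le> real (card (rich_pairs X \<H> t)) * real CARD('k) ^ (CARD('d) - 2)"
proof (rule sum_bounded_above)
  fix p assume "p \<in> rich_pairs X \<H> t"
  then obtain H H' where p: "p = (H, H')" "H \<in> \<H>" "H' \<in> \<H>" "H \<noteq> H'"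
    by (auto simp: rich_pairs_def)
  have "card (X \<inter> H \<inter> H') \<le> card (H \<inter> H')" by (rule card_mono) auto
  also have "\<dots> \<le> CARD('k) ^ (CARD('d) - 2)" using p assms by (intro card_hyperplane_Int_le) auto
  finally have "real (card (X \<inter> H \<inter> H')) \<le> real (CARD('k) ^ (CARD('d) - 2))"
    by (simp only: of_nat_le_iff)
  then show "(case p of (H, H') \<Rightarrow> real (card (X \<inter> H \<inter> H')))
      \<le> real CARD('k) ^ (CARD('d) - 2)"
    using p(1) by simp
qed

text \<open>Here \<open>s\<close> stands for q^((d-1)/2). The constant 4 in \<open>big\<close> is
  what yields I >= 2n, so the subtracted I is at most half of I^2/n.\<close>

lemma quadratic_excess_ge:
  fixes I n K s h :: real
  assumes "0 < n" "0 \<le> h" "0 \<le> K" "0 \<le> s"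
    and I: "K * s * sqrt (n * h) \<le> I" and big: "4 * n \<le> K\<^sup>2 * s\<^sup>2 * h"
  shows "K\<^sup>2 * s\<^sup>2 * h / 2 \<le> I\<^sup>2 / n - I"
proof -
  have sq: "(K * s * sqrt (n * h))\<^sup>2 = n * (K\<^sup>2 * s\<^sup>2 * h)"
    using assms by (simp add: power_mult_distrib)
  have I0: "0 \<le> I" using I by (rule order_trans[rotated]) (use assms in simp)
  have I2: "n * (K\<^sup>2 * s\<^sup>2 * h) \<le> I\<^sup>2"
    unfolding sq[symmetric] by (rule power_mono[OF I]) (use assms in simp)
  have "(2 * n)\<^sup>2 \<le> n * (K\<^sup>2 * s\<^sup>2 * h)"
    using mult_left_mono[OF big, of n] \<open>0 < n\<close> by (simp add: power2_eq_square mult_ac)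
  with I2 have "(2 * n)\<^sup>2 \<le> I\<^sup>2" by linarith
  then have "2 * n \<le> I" using I0 by (rule power2_le_imp_le)
  then have "2 * n * I \<le> I\<^sup>2" using I0 by (simp add: power2_eq_square mult_right_mono)
  then have "2 * I \<le> I\<^sup>2 / n" using \<open>0 < n\<close> by (simp add: field_simps)
  moreover have "K\<^sup>2 * s\<^sup>2 * h \<le> I\<^sup>2 / n" using I2 \<open>0 < n\<close> by (simp add: field_simps)
  ultimately show ?thesis by linarith
qed

theorem theorem5p2:
  fixes X :: "('k::{field,finite} ^ 'd::finite) set"
    and \<H> :: "('k ^ 'd) set set"
    and q d n h :: nat
    and \<E> :: real
  assumes q: "q = CARD('k)"
    and d: "d = CARD('d)" "d \<ge> 2"
    and X: "X \<noteq> {}"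
    and hyperplanes: "\<H> \<noteq> {}" "\<forall>H\<in>\<H>. affine_hyperplane H"
    and n: "n = card X"
    and h: "h = card \<H>"
    and energy: "\<E> = hyperplane_energy X \<H>"
  shows
    "(\<E> > 0 \<longrightarrow> (\<forall>\<eta>::real. 0 < \<eta> \<and> \<eta> < 1 \<longrightarrow>
        (\<Sum>(H, H') \<in> rich_pairs X \<H> (\<eta> * (\<E> / (real h)\<^sup>2)). real (card (X \<inter> H \<inter> H')))
          \<ge> (1 - \<eta>) * \<E> \<and>
        real (card (rich_pairs X \<H> (\<eta> * (\<E> / (real h)\<^sup>2))))
          \<ge> (1 - \<eta>) * \<E> / real q ^ (d - 2) \<and>
        (\<forall>(H, H') \<in> rich_pairs X \<H> (\<eta> * (\<E> / (real h)\<^sup>2)). \<not> parallel H H')))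
     \<and>
     (\<forall>K::real. K > 0
        \<and> real (incidences X \<H>) - real n * real h / real q
            \<ge> K * real q powr ((real d - 1) / 2) * sqrt (real n * real h)
        \<and> K\<^sup>2 * real q ^ (d - 1) * real h \<ge> 4 * real n
       \<longrightarrow>
        real (card {(H, H') \<in> \<H> \<times> \<H>. \<not> parallel H H' \<and>
                  real (card (X \<inter> H \<inter> H')) \<ge> K\<^sup>2 * real q ^ (d - 1) / (4 * real h)})
          \<ge> K\<^sup>2 * real q * real h / 4 \<and>
        (\<forall>C\<^sub>1::real. C\<^sub>1 \<ge> 1 \<and> real h \<le> C\<^sub>1 * K * real q powr ((real d - 1) / 2) \<longrightarrow>
           K\<^sup>2 * real q ^ (d - 1) / (4 * real h)
             \<ge> K * real q powr ((real d - 1) / 2) / (4 * C\<^sub>1)))"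
proof -
  define s where "s = real q powr ((real d - 1) / 2)"
  let ?R = "\<lambda>\<eta>. rich_pairs X \<H> (\<eta> * (\<E> / (real h)\<^sup>2))"
  have qpos: "0 < real q" unfolding q by simp
  have npos: "0 < real n" using X n by (simp add: card_gt_0_iff)
  have hpos: "0 < real h" using hyperplanes(1) h by (simp add: card_gt_0_iff)
  have s0: "0 < s" using qpos by (simp add: s_def)
  have "s\<^sup>2 = real q powr real (d - 1)"
    using d(2) by (simp add: s_def power2_eq_square of_nat_diff flip: powr_add)
  then have s2: "s\<^sup>2 = real q ^ (d - 1)" using qpos by (simp add: powr_realpow)
  have first: "(1 - \<eta>) * \<E> \<le> (\<Sum>(H, H') \<in> ?R \<eta>. real (card (X \<inter> H \<inter> H')))
      \<and> (1 - \<eta>) * \<E> / real q ^ (d - 2) \<le> real (card (?R \<eta>))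
      \<and> (\<forall>(H, H') \<in> ?R \<eta>. \<not> parallel H H')"
    if "\<E> > 0" "0 < \<eta>" for \<eta>
  proof -
    have t: "0 < \<eta> * (\<E> / (real h)\<^sup>2)" using that hpos by simp
    \<comment> \<open>The threshold is scaled so that h^2 poor pairs lose at most the fraction
      \<eta> of the energy.\<close>
    have "(1 - \<eta>) * \<E> = \<E> - \<eta> * (\<E> / (real h)\<^sup>2) * (real (card \<H>))\<^sup>2"
      using hpos by (simp add: h[symmetric] algebra_simps)
    with rich_pairs_energy_ge[of X \<H> "\<eta> * (\<E> / (real h)\<^sup>2)"] t energy
    have E: "(1 - \<eta>) * \<E> \<le> (\<Sum>(H, H') \<in> ?R \<eta>. real (card (X \<inter> H \<inter> H')))" by simp
    also have "\<dots> \<le> real (card (?R \<eta>)) * real q ^ (d - 2)"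
      unfolding q d(1) by (rule sum_rich_pairs_le[OF hyperplanes(2)])
    finally have "(1 - \<eta>) * \<E> / real q ^ (d - 2) \<le> real (card (?R \<eta>))"
      using qpos by (simp add: divide_le_eq)
    with E rich_pairs_not_parallel[OF hyperplanes(2) t] show ?thesis by blast
  qed
  have second: "K\<^sup>2 * real q * real h / 4
      \<le> real (card {(H, H') \<in> \<H> \<times> \<H>. \<not> parallel H H' \<and>
            K\<^sup>2 * real q ^ (d - 1) / (4 * real h) \<le> real (card (X \<inter> H \<inter> H'))})"
    (is "_ \<le> real (card ?P)")
    if K: "K > 0" "K * s * sqrt (real n * real h) \<le> real (incidences X \<H>) - real n * real h / real q"
      "4 * real n \<le> K\<^sup>2 * real q ^ (d - 1) * real h" for K
  proof -
    \<comment> \<open>The expected count nh/q is nonnegative, so the lower bound on the excess also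
      bounds the incidences themselves.\<close>
    have "0 \<le> real n * real h / real q" by simp
    with K(2) have "K * s * sqrt (real n * real h) \<le> real (incidences X \<H>)" by linarith
    then have E: "K\<^sup>2 * s\<^sup>2 * real h / 2 \<le> \<E>"
      unfolding energy hyperplane_energy_def n[symmetric]
      using npos hpos K(1,3) s0 by (intro quadratic_excess_ge) (simp_all add: s2)
    moreover have "0 < K\<^sup>2 * s\<^sup>2 * real h / 2" using K(1) s0 hpos by simp
    ultimately have Epos: "\<E> > 0" by linarith
    note R = first[OF Epos, of "1/2"]
    \<comment> \<open>One factor 1/2 comes from the energy bound \<open>E\<close>, the other from
      \<eta> = 1/2.\<close>
    have "K\<^sup>2 * real q ^ (d - 1) / (4 * real h) = K\<^sup>2 * s\<^sup>2 * real h / 2 / (2 * (real h)\<^sup>2)"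
      using hpos unfolding s2 by (simp add: power2_eq_square)
    also have "\<dots> \<le> \<E> / (2 * (real h)\<^sup>2)" using E by (rule divide_right_mono) simp
    finally have thr: "K\<^sup>2 * real q ^ (d - 1) / (4 * real h) \<le> 1/2 * (\<E> / (real h)\<^sup>2)" by simp
    have "?R (1/2) \<subseteq> ?P"
    proof
      fix p assume p: "p \<in> ?R (1/2)"
      obtain H H' where [simp]: "p = (H, H')" by force
      have "\<not> parallel H H'" using R p by auto
      moreover have "H \<in> \<H>" "H' \<in> \<H>" "1/2 * (\<E> / (real h)\<^sup>2) \<le> real (card (X \<inter> H \<inter> H'))"
        using p by (auto simp: rich_pairs_def)
      ultimately show "p \<in> ?P" using order_trans[OF thr] by simp
    qed
    then have sub: "card (?R (1/2)) \<le> card ?P" by (intro card_mono) auto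
    \<comment> \<open>Dividing q^(d-1) by the maximal contribution q^(d-2) of a pair leaves the
      single factor q.\<close>
    have "K\<^sup>2 * real q * real h / 4 = K\<^sup>2 * s\<^sup>2 * real h / 2 / (2 * real q ^ (d - 2))"
    proof -
      have "d - 1 = Suc (d - 2)" using d(2) by simp
      then have "real q ^ (d - 1) = real q * real q ^ (d - 2)" by simp
      then show ?thesis using qpos by (simp add: s2)
    qed
    also have "\<dots> \<le> \<E> / (2 * real q ^ (d - 2))" using E by (rule divide_right_mono) simp
    also have "\<dots> = (1 - 1/2) * \<E> / real q ^ (d - 2)" by simp
    also have "\<dots> \<le> real (card (?R (1/2)))" using R by simp
    also have "\<dots> \<le> real (card ?P)" using sub by simp
    finally show ?thesis .
  qed
  have third: "K * s / (4 * C) \<le> K\<^sup>2 * real q ^ (d - 1) / (4 * real h)"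
    if "K > 0" "C \<ge> 1" "real h \<le> C * K * s" for K C
  proof -
    \<comment> \<open>This is the cap on h multiplied by K s; dividing by 4 C h then gives the
      claim, as s^2 = q^(d-1).\<close>
    have "K * s * real h \<le> K * s * (C * K * s)" using that s0 by (intro mult_left_mono) auto
    then show ?thesis using that hpos unfolding s2[symmetric]
      by (simp add: field_simps power2_eq_square)
  qed
  show ?thesis
    using first second third unfolding s_def[symmetric] by blast
qed

end
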